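(* Let $P$ be a graph property such that whenever a spanning subgraph of a graph $G$ has $P$, so does $G$. If $f$ and $f_0$ are monotone, forcibly $P$ functions, and $f_0$ is weakly optimal, then $f_0(\pi) \ge f(\pi)$ for every graphical sequence $\pi$.
   Context: Graphs are finite, undirected, without loops or multiple edges. A degree sequence of a graph on $n$ vertices is a sequence $\pi=(d_1,\dots,d_n)$ consisting of its vertex degrees, written in nondecreasing order. A sequence of integers $\pi$ is graphical if there is a graph $G$ having $\pi$ as a degree sequence; such a $G$ is called a realization of $\pi$. For integer sequences $\pi=(d_1,\dots,d_n)$ and $\pi'=(d_1',\dots,d_n')$ of the same length, $\pi'$ majorizes $\pi$, written $\pi'\ge\pi$, if $d_j'\ge d_j$ for $1\le j\le n$. For a graph property $P$, a graphical degree sequence $\pi$ is forcibly $P$ graphical if every realization of $\pi$ has property $P$. A forcibly $P$ function is a function $f:\{\text{graphical degree sequences}\}\to\{0,1\}$ such that $f(\pi)=1$ implies that $\pi$ is forcibly $P$ graphical ($f(\pi)=0$ implies nothing in this regard). A forcibly $P$ function $f$ is monotone if for graphical sequences $\pi,\pi'$, $\pi'\ge\pi$ and $f(\pi)=1$ imply $f(\pi')=1$. It is weakly optimal if $f(\pi)=0$ implies that there exists a graphical sequence $\pi'\ge\pi$ such that $\pi'$ has a realization $G'$ without property $P$. *)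

theory Defs
  imports Graph_Theory.Graph_Theory "HOL-Library.FuncSet" "HOL-Library.Multiset"
begin

text \<open>
  Finite simple graphs are the symmetric digraphs \<^const>\<open>pair_graph\<close>; an edge
  \<open>{u, v}\<close> is the pair of arcs \<open>(u, v)\<close>, \<open>(v, u)\<close>, so the degree of a vertex is its
  \<^const>\<open>out_degree\<close>. Every finite graph is isomorphic to one with vertices in \<^typ>\<open>nat\<close>,
  and graph properties are isomorphism invariant, so it suffices to consider such graphs.
  The null graph is admitted.
\<close>

type_synonym ngraph = "nat pair_pre_digraph"

definition degree_sequence :: "ngraph \<Rightarrow> int list" where
  "degree_sequence G =
    sorted_list_of_multiset (image_mset (\<lambda>v. int (out_degree G v)) (mset_set (pverts G)))"

definition realization :: "ngraph \<Rightarrow> int list \<Rightarrow> bool" where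
  "realization G \<pi> \<longleftrightarrow> pair_graph G \<and> degree_sequence G = \<pi>"

definition graphical :: "int list \<Rightarrow> bool" where
  "graphical \<pi> \<longleftrightarrow> (\<exists>G. realization G \<pi>)"

definition majorizes :: "int list \<Rightarrow> int list \<Rightarrow> bool" where
  "majorizes \<pi>' \<pi> \<longleftrightarrow> length \<pi>' = length \<pi> \<and> (\<forall>j < length \<pi>. \<pi>' ! j \<ge> \<pi> ! j)"

text \<open>The values of a property outside \<^const>\<open>pair_graph\<close> are irrelevant.\<close>

definition graph_property :: "(ngraph \<Rightarrow> bool) \<Rightarrow> bool" where
  "graph_property P \<longleftrightarrow>
    (\<forall>G H. pair_graph G \<and> pair_graph H \<and> digraph_iso (with_proj G) (with_proj H) \<longrightarrow> P G = P H)"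

definition spanning_supergraph_closed :: "(ngraph \<Rightarrow> bool) \<Rightarrow> bool" where
  "spanning_supergraph_closed P \<longleftrightarrow>
    (\<forall>G H. pair_graph G \<and> pair_graph H \<and> spanning (with_proj H) (with_proj G) \<and> P H \<longrightarrow> P G)"

definition forcibly_graphical :: "(ngraph \<Rightarrow> bool) \<Rightarrow> int list \<Rightarrow> bool" where
  "forcibly_graphical P \<pi> \<longleftrightarrow> graphical \<pi> \<and> (\<forall>G. realization G \<pi> \<longrightarrow> P G)"

text \<open>
  The functions below have the graphical sequences as their domain; their values elsewhere
  are irrelevant.
\<close>

definition forcibly_function :: "(ngraph \<Rightarrow> bool) \<Rightarrow> (int list \<Rightarrow> nat) \<Rightarrow> bool" where
  "forcibly_function P f \<longleftrightarrow>
    f \<in> {\<pi>. graphical \<pi>} \<rightarrow> {0, 1} \<and>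
    (\<forall>\<pi>. graphical \<pi> \<and> f \<pi> = 1 \<longrightarrow> forcibly_graphical P \<pi>)"

definition monotone_function :: "(int list \<Rightarrow> nat) \<Rightarrow> bool" where
  "monotone_function f \<longleftrightarrow>
    (\<forall>\<pi> \<pi>'. graphical \<pi> \<and> graphical \<pi>' \<and> majorizes \<pi>' \<pi> \<and> f \<pi> = 1 \<longrightarrow> f \<pi>' = 1)"

definition weakly_optimal :: "(ngraph \<Rightarrow> bool) \<Rightarrow> (int list \<Rightarrow> nat) \<Rightarrow> bool" where
  "weakly_optimal P f \<longleftrightarrow>
    (\<forall>\<pi>. graphical \<pi> \<and> f \<pi> = 0 \<longrightarrow>
      (\<exists>\<pi>'. graphical \<pi>' \<and> majorizes \<pi>' \<pi> \<and> (\<exists>G'. realization G' \<pi>' \<and> \<not> P G')))"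

end

theory Submission
  imports Defs
begin

text \<open>
  If \<open>f0\<close> were smaller than \<open>f\<close> at some graphical \<open>\<pi>\<close>, then \<open>f0 \<pi> = 0\<close> and \<open>f \<pi> = 1\<close>, as
  only the values 0 and 1 occur. Weak optimality of \<open>f0\<close> then yields a graphical sequence above
  \<open>\<pi>\<close> with a realization that fails \<open>P\<close>, whereas monotonicity carries the value 1 of \<open>f\<close> up to
  that sequence and so forces \<open>P\<close> on all of its realizations.
\<close>

theorem theorem1p3:
  fixes P :: "ngraph \<Rightarrow> bool" and f f0 :: "int list \<Rightarrow> nat"
  assumes "graph_property P"
    and "spanning_supergraph_closed P"
    and "forcibly_function P f" and "monotone_function f"
    and "forcibly_function P f0" and "monotone_function f0"
    and "weakly_optimal P f0"
  shows "\<forall>\<pi>. graphical \<pi> \<longrightarrow> f0 \<pi> \<ge> f \<pi>"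
proof (intro allI impI)
  fix \<pi> assume g: "graphical \<pi>"
  show "f \<pi> \<le> f0 \<pi>"
  proof (rule ccontr)
    assume lt: "\<not> f \<pi> \<le> f0 \<pi>"
    have "f \<pi> \<in> {0, 1}" "f0 \<pi> \<in> {0, 1}"
      using assms(3,5) g by (auto simp: forcibly_function_def)
    with lt have f: "f \<pi> = 1" and f0: "f0 \<pi> = 0"
      by auto
    from assms(7) g f0 obtain \<pi>' G' where g': "graphical \<pi>'" and maj: "majorizes \<pi>' \<pi>"
      and G': "realization G' \<pi>'" "\<not> P G'"
      unfolding weakly_optimal_def by blast
    have "f \<pi>' = 1"
      using assms(4) g g' maj f unfolding monotone_function_def by blast
    with assms(3) g' have "forcibly_graphical P \<pi>'"
      unfolding forcibly_function_def by blast
    with G' show False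
      unfolding forcibly_graphical_def by blast
  qed
qed

end
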